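(* Let $n\geq 1$ and let $H,G\leq W_n=\mathrm{Aut}(T_n)$ be subgroups with $|H|=|G|$ and $H\cap K_n=\{\mathrm{id}\}$. Then $H$ is elementwise $K_n$-conjugate into $G$ if and only if $H$ is globally $K_n$-conjugate into $G$.
   Context: $T_n$ denotes the complete binary rooted tree with $n$ levels (so $2^n$ vertices at level $n$), and $W_n=\mathrm{Aut}(T_n)$ is its automorphism group (the $n$-fold iterated wreath product of $C_2$). Restriction to the first $n-1$ levels gives a surjection $\pi_n:W_n\to W_{n-1}$, and $K_n=\ker(\pi_n)$, an elementary abelian $2$-group of rank $2^{n-1}$. For $x,a\in W_n$ write $x^a=a^{-1}xa$. A subgroup $H\leq W_n$ is elementwise $K_n$-conjugate into $G\leq W_n$ if for every $h\in H$ there exists $a\in K_n$ with $h^a\in G$. $H$ is globally $K_n$-conjugate into $G$ if there exists $a\in K_n$ with $a^{-1}Ha\subseteq G$. *)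

theory Defs
  imports "HOL-Algebra.Bij" "HOL-Algebra.Coset"
begin

text \<open>A vertex of the complete binary rooted tree is the word of left/right choices
  leading to it from the root; its level is the length of the word.\<close>

definition tree_vertices :: "nat \<Rightarrow> bool list set"
  where "tree_vertices n = {v. length v \<le> n}"

definition tree_adj :: "bool list \<Rightarrow> bool list \<Rightarrow> bool"
  where "tree_adj u v \<longleftrightarrow> (\<exists>b. v = u @ [b] \<or> u = v @ [b])"

definition tree_aut :: "nat \<Rightarrow> (bool list \<Rightarrow> bool list) set"
  where "tree_aut n =
    {f \<in> Bij (tree_vertices n). f [] = [] \<and>
       (\<forall>u \<in> tree_vertices n. \<forall>v \<in> tree_vertices n. tree_adj (f u) (f v) \<longleftrightarrow> tree_adj u v)}"

definition W :: "nat \<Rightarrow> (bool list \<Rightarrow> bool list) monoid"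
  where "W n = BijGroup (tree_vertices n) \<lparr>carrier := tree_aut n\<rparr>"

definition level_proj :: "nat \<Rightarrow> (bool list \<Rightarrow> bool list) \<Rightarrow> (bool list \<Rightarrow> bool list)"
  where "level_proj n f = restrict f (tree_vertices (n - 1))"

definition K :: "nat \<Rightarrow> (bool list \<Rightarrow> bool list) set"
  where "K n = kernel (W n) (W (n - 1)) (level_proj n)"

definition conj_by :: "nat \<Rightarrow> (bool list \<Rightarrow> bool list) \<Rightarrow> (bool list \<Rightarrow> bool list) \<Rightarrow> (bool list \<Rightarrow> bool list)"
  where "conj_by n x a = inv\<^bsub>W n\<^esub> a \<otimes>\<^bsub>W n\<^esub> x \<otimes>\<^bsub>W n\<^esub> a"

definition elementwise_K_conj_into ::
    "nat \<Rightarrow> (bool list \<Rightarrow> bool list) set \<Rightarrow> (bool list \<Rightarrow> bool list) set \<Rightarrow> bool"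
  where "elementwise_K_conj_into n H G \<longleftrightarrow> (\<forall>h \<in> H. \<exists>a \<in> K n. conj_by n h a \<in> G)"

definition globally_K_conj_into ::
    "nat \<Rightarrow> (bool list \<Rightarrow> bool list) set \<Rightarrow> (bool list \<Rightarrow> bool list) set \<Rightarrow> bool"
  where "globally_K_conj_into n H G \<longleftrightarrow> (\<exists>a \<in> K n. (\<lambda>h. conj_by n h a) ` H \<subseteq> G)"

lemma subgroup_tree_aut: "subgroup (tree_aut n) (BijGroup (tree_vertices n))"
proof (rule group.subgroupI [OF group_BijGroup])
  let ?V = "tree_vertices n"
  show "tree_aut n \<subseteq> carrier (BijGroup ?V)"
    by (auto simp: tree_aut_def BijGroup_def)
  have "(\<lambda>x\<in>?V. x) \<in> tree_aut n"
    by (auto simp: tree_aut_def id_Bij) (simp add: tree_vertices_def)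
  then show "tree_aut n \<noteq> {}" by blast
  fix f assume f: "f \<in> tree_aut n"
  then have fB: "f \<in> Bij ?V" by (simp add: tree_aut_def)
  then have bij: "bij_betw f ?V ?V" by (simp add: Bij_def)
  have nil: "[] \<in> ?V" by (simp add: tree_vertices_def)
  have i1: "inv_into ?V f x \<in> ?V" "f (inv_into ?V f x) = x" if "x \<in> ?V" for x
    using bij that by (auto simp: bij_betw_def inv_into_into f_inv_into_f)
  have "inv_into ?V f [] = []"
    using f bij nil by (metis (mono_tags, lifting) bij_betw_def inv_into_f_f mem_Collect_eq tree_aut_def)
  moreover have "tree_adj (inv_into ?V f u) (inv_into ?V f v) \<longleftrightarrow> tree_adj u v"
    if "u \<in> ?V" "v \<in> ?V" for u v
    using f i1 [OF that(1)] i1 [OF that(2)] by (fastforce simp: tree_aut_def)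
  ultimately show "inv\<^bsub>BijGroup ?V\<^esub> f \<in> tree_aut n"
    using fB nil by (simp add: inv_BijGroup tree_aut_def restrict_inv_into_Bij)
  fix g assume g: "g \<in> tree_aut n"
  then have gB: "g \<in> Bij ?V" by (simp add: tree_aut_def)
  then have "\<And>x. x \<in> ?V \<Longrightarrow> g x \<in> ?V" using Bij_imp_funcset by blast
  with f g fB gB nil show "f \<otimes>\<^bsub>BijGroup ?V\<^esub> g \<in> tree_aut n"
    by (auto simp: BijGroup_def tree_aut_def compose_Bij) (auto simp: compose_def)
qed

theorem group_W: "group (W n)"
  unfolding W_def
  by (rule subgroup.subgroup_is_group [OF subgroup_tree_aut group_BijGroup])

lemma tree_aut_child:
  assumes f: "f \<in> tree_aut n"
  shows "length v < n \<Longrightarrow> \<exists>c. f (v @ [b]) = f v @ [c]"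
proof (induction v arbitrary: b rule: rev_induct)
  case Nil
  have "[] \<in> tree_vertices n" "[b] \<in> tree_vertices n" "tree_adj [] [b]"
    using Nil by (auto simp: tree_vertices_def tree_adj_def)
  then have "tree_adj (f []) (f [b])" using f by (auto simp: tree_aut_def)
  then show ?case using f by (auto simp: tree_aut_def tree_adj_def)
next
  case (snoc x u)
  let ?v = "u @ [x]" and ?w = "(u @ [x]) @ [b]"
  have V: "u \<in> tree_vertices n" "?v \<in> tree_vertices n" "?w \<in> tree_vertices n"
    using snoc by (auto simp: tree_vertices_def)
  have "tree_adj ?v ?w" by (simp add: tree_adj_def)
  then have adj: "tree_adj (f ?v) (f ?w)" using f V unfolding tree_aut_def by blast
  obtain c where c: "f ?v = f u @ [c]" using snoc by force
  have "inj_on f (tree_vertices n)" using f by (simp add: tree_aut_def Bij_def bij_betw_def)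
  moreover have "u \<noteq> ?w" by simp
  ultimately have "f u \<noteq> f ?w" using V by (auto dest!: inj_onD)
  with adj c show ?case by (auto simp: tree_adj_def)
qed

lemma tree_aut_length:
  assumes "f \<in> tree_aut n"
  shows "v \<in> tree_vertices n \<Longrightarrow> length (f v) = length v"
proof (induction v rule: rev_induct)
  case Nil then show ?case using assms by (simp add: tree_aut_def)
next
  case (snoc x xs)
  then have "length xs < n" by (simp add: tree_vertices_def)
  from tree_aut_child [OF assms this, of x] snoc show ?case
    by (auto simp: tree_vertices_def)
qed

lemma tree_vertices_pred: "v \<in> tree_vertices (n - 1) \<Longrightarrow> v \<in> tree_vertices n"
  by (auto simp: tree_vertices_def)

lemma level_proj_tree_aut:
  assumes f: "f \<in> tree_aut n"
  shows "level_proj n f \<in> tree_aut (n - 1)"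
proof -
  let ?V = "tree_vertices n" and ?U = "tree_vertices (n - 1)"
  have sub: "?U \<subseteq> ?V" using tree_vertices_pred by blast
  have bij: "bij_betw f ?V ?V" using f by (simp add: tree_aut_def Bij_def)
  have len: "\<And>v. v \<in> ?V \<Longrightarrow> length (f v) = length v" by (rule tree_aut_length [OF f])
  have "f ` ?U = ?U"
  proof
    show "f ` ?U \<subseteq> ?U" using len sub by (auto simp: tree_vertices_def)
    show "?U \<subseteq> f ` ?U"
    proof
      fix u assume u: "u \<in> ?U"
      then obtain v where v: "v \<in> ?V" "u = f v"
        using bij sub by (auto simp: bij_betw_def)
      then have "v \<in> ?U" using len [OF v(1)] u by (simp add: tree_vertices_def)
      with v show "u \<in> f ` ?U" by blast
    qed
  qed
  then have "bij_betw f ?U ?U"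
    using bij sub by (auto simp: bij_betw_def intro: inj_on_subset)
  then have "restrict f ?U \<in> Bij ?U"
    by (simp add: Bij_def)
  moreover have "[] \<in> ?U" by (simp add: tree_vertices_def)
  ultimately show ?thesis
    using f sub unfolding tree_aut_def level_proj_def
    by (simp add: subset_iff)
qed

theorem level_proj_hom: "level_proj n \<in> hom (W n) (W (n - 1))"
proof (rule homI)
  fix f assume "f \<in> carrier (W n)"
  then show "level_proj n f \<in> carrier (W (n - 1))"
    using level_proj_tree_aut by (simp add: W_def)
next
  fix f g assume fg: "f \<in> carrier (W n)" "g \<in> carrier (W n)"
  then have fg: "f \<in> tree_aut n" "g \<in> tree_aut n" by (simp_all add: W_def)
  then have B: "f \<in> Bij (tree_vertices n)" "g \<in> Bij (tree_vertices n)"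
      "level_proj n f \<in> Bij (tree_vertices (n - 1))" "level_proj n g \<in> Bij (tree_vertices (n - 1))"
    using level_proj_tree_aut by (auto simp: tree_aut_def)
  have "g v \<in> tree_vertices (n - 1)" if "v \<in> tree_vertices (n - 1)" for v
    using tree_aut_length [OF fg(2)] tree_vertices_pred [OF that] that by (simp add: tree_vertices_def)
  then show "level_proj n (f \<otimes>\<^bsub>W n\<^esub> g) = level_proj n f \<otimes>\<^bsub>W (n - 1)\<^esub> level_proj n g"
    using B tree_vertices_pred
    by (auto simp: W_def BijGroup_def level_proj_def compose_def restrict_def fun_eq_iff)
qed

end

theory Submission
  imports Defs
begin

text \<open>
  The projection \<open>\<pi>\<^sub>n\<close> is injective on \<open>H\<close>, and comparing cardinalities, it is also injective on
  \<open>G\<close> with \<open>\<pi>\<^sub>n(G) = \<pi>\<^sub>n(H)\<close>. Hence there is an isomorphism \<open>\<sigma> : H \<rightarrow> G\<close> over \<open>W\<^sub>n\<^sub>-\<^sub>1\<close>, and the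
  failure of \<open>h\<close> and \<open>\<sigma> h\<close> to agree below a vertex \<open>v\<close> in the set \<open>X\<close> of vertices of level
  \<open>n - 1\<close> is a 1-cocycle \<open>d h v\<close> with values in the permutation module \<open>K\<^sub>n = \<int>\<^sub>2\<^bsup>X\<^esup>\<close>. Conjugation by \<open>K\<^sub>n\<close> does not
  change how \<open>h\<close> acts below a vertex fixed by \<open>h\<close>, so elementwise conjugacy says that \<open>d h v = 0\<close>
  whenever \<open>h v = v\<close>. By Shapiro's lemma a class in \<open>H\<^sup>1\<close> of a permutation module is detected by
  these restrictions to point stabilisers, so \<open>d\<close> is a coboundary, which gives the global conjugator.
\<close>

section \<open>Cocycles vanishing on point stabilisers\<close>

text \<open>Booleans stand for the group of order two, with \<open>\<noteq>\<close> as addition.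
  Each orbit gets a base point \<open>rep\<close>, and \<open>tr x\<close> is a group element
  carrying the base point to \<open>x\<close>.\<close>

lemma (in group) cocycle_vanishing_on_stabilisers_is_coboundary:
  fixes act :: "'a \<Rightarrow> 'x \<Rightarrow> 'x" and d :: "'a \<Rightarrow> 'x \<Rightarrow> bool"
  assumes act_closed: "\<And>g x. g \<in> carrier G \<Longrightarrow> x \<in> X \<Longrightarrow> act g x \<in> X"
    and act_one: "\<And>x. x \<in> X \<Longrightarrow> act \<one> x = x"
    and act_mult: "\<And>g h x. g \<in> carrier G \<Longrightarrow> h \<in> carrier G \<Longrightarrow> x \<in> X \<Longrightarrow> act (g \<otimes> h) x = act g (act h x)"
    and cocycle: "\<And>g h x. g \<in> carrier G \<Longrightarrow> h \<in> carrier G \<Longrightarrow> x \<in> X \<Longrightarrow>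
          d (g \<otimes> h) x \<longleftrightarrow> d g (act h x) \<noteq> d h x"
    and stab: "\<And>g x. g \<in> carrier G \<Longrightarrow> x \<in> X \<Longrightarrow> act g x = x \<Longrightarrow> \<not> d g x"
  shows "\<exists>A :: 'x \<Rightarrow> bool. \<forall>g\<in>carrier G. \<forall>x\<in>X. d g x \<longleftrightarrow> A (act g x) \<noteq> A x"
proof -
  define orb where "orb x = {y \<in> X. \<exists>g\<in>carrier G. act g y = x}" for x
  define rep where "rep x = (SOME y. y \<in> orb x)" for x
  define tr where "tr x = (SOME g. g \<in> carrier G \<and> act g (rep x) = x)" for x
  \<comment> \<open>The only possible choice if \<open>A\<close> is to vanish at every base point:
    the coboundary equation for \<open>tr x\<close> at \<open>rep x\<close> then reads
    \<open>d (tr x) (rep x) = A x\<close>.\<close>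
  define A where "A x = d (tr x) (rep x)" for x
  have inv_act: "act (inv g) (act g x) = x" if "g \<in> carrier G" "x \<in> X" for g x
    using that act_mult[of "inv g" g x] act_one by simp
  have rep: "rep x \<in> orb x" if "x \<in> X" for x
  proof -
    have "x \<in> orb x" using that act_one by (auto simp: orb_def)
    then show ?thesis unfolding rep_def by (rule someI)
  qed
  have tr: "tr x \<in> carrier G \<and> act (tr x) (rep x) = x" if "x \<in> X" for x
  proof -
    have "\<exists>g. g \<in> carrier G \<and> act g (rep x) = x" using rep[OF that] by (auto simp: orb_def)
    then show ?thesis unfolding tr_def by (rule someI_ex)
  qed
  have repX: "rep x \<in> X" if "x \<in> X" for x
    using rep[OF that] by (simp add: orb_def)
  \<comment> \<open>Two elements sending \<open>y\<close> to the same point differ by an element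
    fixing \<open>y\<close>, where \<open>d\<close> vanishes.\<close>
  have same: "d g y = d h y"
    if "g \<in> carrier G" "h \<in> carrier G" "y \<in> X" "act g y = act h y" for g h y
  proof -
    have k: "inv h \<otimes> g \<in> carrier G" using that by simp
    have fix': "act (inv h \<otimes> g) y = y" using that inv_act by (simp add: act_mult)
    have "h \<otimes> (inv h \<otimes> g) = g" using that by (simp add: m_assoc[symmetric])
    then have "d g y \<longleftrightarrow> d h (act (inv h \<otimes> g) y) \<noteq> d (inv h \<otimes> g) y"
      using cocycle[OF that(2) k that(3)] by simp
    then show ?thesis using fix' stab[OF k that(3) fix'] by simp
  qed
  have rep_act: "rep (act g x) = rep x" if "g \<in> carrier G" "x \<in> X" for g x
  proof -
    \<comment> \<open>\<open>rep\<close> depends on its argument only through the set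
      \<open>orb\<close>, so equal orbits receive the same base point.\<close>
    have "orb (act g x) = orb x"
    proof (intro equalityI subsetI)
      fix y assume "y \<in> orb (act g x)"
      then obtain h where h: "h \<in> carrier G" "y \<in> X" "act h y = act g x" by (auto simp: orb_def)
      then have "act (inv g \<otimes> h) y = x" using that inv_act by (simp add: act_mult)
      then show "y \<in> orb x" using h that by (auto simp: orb_def intro!: bexI[of _ "inv g \<otimes> h"])
    next
      fix y assume "y \<in> orb x"
      then obtain h where h: "h \<in> carrier G" "y \<in> X" "act h y = x" by (auto simp: orb_def)
      then have "act (g \<otimes> h) y = act g x" using that by (simp add: act_mult)
      then show "y \<in> orb (act g x)" using h that by (auto simp: orb_def intro!: bexI[of _ "g \<otimes> h"])
    qed
    then show ?thesis by (simp add: rep_def)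
  qed
  have "d g x \<longleftrightarrow> A (act g x) \<noteq> A x" if g: "g \<in> carrier G" and x: "x \<in> X" for g x
  proof -
    have gx: "act g x \<in> X" using act_closed g x .
    have t: "tr x \<in> carrier G" "act (tr x) (rep x) = x" using tr[OF x] by auto
    have t': "tr (act g x) \<in> carrier G" "act (tr (act g x)) (rep x) = act g x"
      using tr[OF gx] rep_act[OF g x] by auto
    \<comment> \<open>\<open>tr (act g x)\<close> and \<open>g \<otimes> tr x\<close> both carry
      \<open>rep x\<close> to \<open>act g x\<close>, so \<open>same\<close> exchanges them.\<close>
    have "A (act g x) = d (g \<otimes> tr x) (rep x)"
      unfolding A_def rep_act[OF g x]
      using same[OF t'(1) _ repX[OF x], of "g \<otimes> tr x"] t t' g repX[OF x] by (simp add: act_mult)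
    also have "\<dots> \<longleftrightarrow> d g x \<noteq> A x"
      using cocycle[OF g t(1) repX[OF x]] t(2) by (simp add: A_def)
    finally show ?thesis by blast
  qed
  then show ?thesis by blast
qed

section \<open>Labels at the last level\<close>

text \<open>The portrait label of an automorphism at \<open>v\<close>. The left child suffices to
  read it off, since injectivity sends the right child to the other edge.\<close>

definition swaps :: "(bool list \<Rightarrow> bool list) \<Rightarrow> bool list \<Rightarrow> bool"
  where "swaps f v \<longleftrightarrow> last (f (v @ [False]))"

definition swap_leaves :: "nat \<Rightarrow> (bool list \<Rightarrow> bool) \<Rightarrow> bool list \<Rightarrow> bool list"
  where "swap_leaves n A = (\<lambda>v \<in> tree_vertices n.
    if length v = n then butlast v @ [last v \<noteq> A (butlast v)] else v)"

lemma carrier_W: "carrier (W n) = tree_aut n"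
  by (simp add: W_def)

lemma finite_carrier_W: "finite (carrier (W n))"
proof -
  have "finite (tree_vertices n)"
    using finite_lists_length_le[of "UNIV :: bool set" n] by (simp add: tree_vertices_def)
  moreover have "carrier (W n) \<subseteq> tree_vertices n \<rightarrow>\<^sub>E tree_vertices n"
    by (auto simp: carrier_W tree_aut_def Bij_def PiE_def bij_betw_def)
  ultimately show ?thesis
    using finite_PiE finite_subset by (metis (no_types, lifting))
qed

lemma mult_W_apply:
  assumes "f \<in> carrier (W n)" "g \<in> carrier (W n)" "v \<in> tree_vertices n"
  shows "(f \<otimes>\<^bsub>W n\<^esub> g) v = f (g v)"
  using assms by (simp add: W_def BijGroup_def tree_aut_def compose_def)

lemma one_W: "\<one>\<^bsub>W n\<^esub> = (\<lambda>v \<in> tree_vertices n. v)"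
  by (simp add: W_def BijGroup_def)

lemma W_length:
  assumes "f \<in> carrier (W n)" "length v \<le> n"
  shows "length (f v) = length v"
  using tree_aut_length assms by (auto simp: carrier_W tree_vertices_def)

lemma W_child:
  assumes f: "f \<in> carrier (W n)" and v: "length v < n"
  shows "f (v @ [b]) = f v @ [b \<noteq> swaps f v]"
proof -
  have f': "f \<in> tree_aut n" using f by (simp add: carrier_W)
  obtain c0 where c0: "f (v @ [False]) = f v @ [c0]" using tree_aut_child[OF f' v] by blast
  obtain c1 where c1: "f (v @ [True]) = f v @ [c1]" using tree_aut_child[OF f' v] by blast
  have "inj_on f (tree_vertices n)" using f' by (simp add: tree_aut_def Bij_def bij_betw_def)
  then have "f (v @ [False]) \<noteq> f (v @ [True])"
    using v by (auto simp: tree_vertices_def dest!: inj_onD)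
  then show ?thesis using c0 c1 by (cases b) (auto simp: swaps_def)
qed

text \<open>The right factor acts first, so the label of \<open>f\<close> is read at
  \<open>g v\<close>. This twisted additivity is the source of the cocycle identity.\<close>

lemma swaps_mult:
  assumes f: "f \<in> carrier (W n)" and g: "g \<in> carrier (W n)" and v: "length v < n"
  shows "swaps (f \<otimes>\<^bsub>W n\<^esub> g) v \<longleftrightarrow> swaps f (g v) \<noteq> swaps g v"
proof -
  have gv: "length (g v) < n" using W_length[OF g] v by simp
  have "(f \<otimes>\<^bsub>W n\<^esub> g) (v @ [False]) = f (g (v @ [False]))"
    using mult_W_apply[OF f g] v by (simp add: tree_vertices_def)
  also have "\<dots> = f (g v) @ [swaps g v \<noteq> swaps f (g v)]"
    by (simp only: W_child[OF g v] W_child[OF f gv]) simp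
  finally show ?thesis unfolding swaps_def[of "f \<otimes>\<^bsub>W n\<^esub> g"] by auto
qed

lemma W_eqI:
  assumes f: "f \<in> carrier (W n)" and g: "g \<in> carrier (W n)" and n: "n \<ge> 1"
    and low: "\<And>v. length v < n \<Longrightarrow> f v = g v"
    and sw: "\<And>v. length v = n - 1 \<Longrightarrow> swaps f v = swaps g v"
  shows "f = g"
proof (rule extensionalityI[of _ "tree_vertices n"])
  show "f \<in> extensional (tree_vertices n)" "g \<in> extensional (tree_vertices n)"
    using f g by (auto simp: carrier_W tree_aut_def Bij_def)
  fix v assume v: "v \<in> tree_vertices n"
  show "f v = g v"
  proof (cases "length v = n")
    case True
    then obtain u b where "v = u @ [b]" "length u = n - 1"
      using n by (cases v rule: rev_cases) auto
    then show ?thesis using W_child[OF f, of u b] W_child[OF g, of u b] low[of u] sw[of u] n by simp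
  next
    case False
    then show ?thesis using v low by (simp add: tree_vertices_def)
  qed
qed

lemma level_proj_eqD:
  assumes "level_proj n f = level_proj n g" "length v \<le> n - 1"
  shows "f v = g v"
  using fun_cong[OF assms(1), of v] assms(2) by (simp add: level_proj_def tree_vertices_def)

lemma K_subset: "K n \<subseteq> carrier (W n)"
  by (auto simp: K_def kernel_def)

lemma K_fixes:
  assumes "a \<in> K n" "length v \<le> n - 1"
  shows "a v = v"
proof -
  have "level_proj n a = \<one>\<^bsub>W (n - 1)\<^esub>" using assms by (simp add: K_def kernel_def)
  from fun_cong[OF this, of v] show ?thesis
    using assms(2) by (simp add: level_proj_def tree_vertices_def one_W)
qed

text \<open>The map is an involution: this gives bijectivity, and adjacency need only be preserved
  in one direction. For \<open>n = 0\<close> the root would be a leaf and would be sent outside the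
  tree.\<close>

lemma swap_leaves_in_K:
  assumes n: "n \<ge> 1"
  shows "swap_leaves n A \<in> K n"
proof -
  let ?V = "tree_vertices n" and ?s = "swap_leaves n A"
  have V: "?s v \<in> ?V" if "v \<in> ?V" for v
    using that n by (auto simp: swap_leaves_def tree_vertices_def)
  have invol: "?s (?s v) = v" if "v \<in> ?V" for v
  proof (cases v rule: rev_cases)
    case Nil then show ?thesis using n by (simp add: swap_leaves_def tree_vertices_def)
  next
    case (snoc u b) then show ?thesis using that by (auto simp: swap_leaves_def tree_vertices_def)
  qed
  have "bij_betw ?s ?V ?V"
    by (rule bij_betwI[of _ _ _ ?s]) (use V invol in auto)
  then have bij: "?s \<in> Bij ?V"
    by (simp add: Bij_def swap_leaves_def)
  have adj1: "tree_adj (?s u) (?s v)" if "u \<in> ?V" "v \<in> ?V" "tree_adj u v" for u v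
  proof -
    have "?s (w @ [b]) = w @ [if length w = n - 1 then b \<noteq> A w else b] \<and> ?s w = w"
      if "w @ [b] \<in> ?V" for w b
      using that by (auto simp: swap_leaves_def tree_vertices_def)
    then show ?thesis using that by (auto simp: tree_adj_def)
  qed
  have "tree_adj (?s u) (?s v) \<longleftrightarrow> tree_adj u v" if "u \<in> ?V" "v \<in> ?V" for u v
    using adj1[OF that] adj1[OF V[OF that(1)] V[OF that(2)]] invol that by auto
  moreover have "?s [] = []" using n by (simp add: swap_leaves_def tree_vertices_def)
  ultimately have "?s \<in> carrier (W n)" using bij by (simp add: carrier_W tree_aut_def)
  moreover have "level_proj n ?s = \<one>\<^bsub>W (n - 1)\<^esub>"
    using n by (auto simp: level_proj_def one_W swap_leaves_def tree_vertices_def restrict_def fun_eq_iff)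
  ultimately show ?thesis by (simp add: K_def kernel_def)
qed

lemma swaps_swap_leaves:
  assumes "n \<ge> 1" "length v = n - 1"
  shows "swaps (swap_leaves n A) v = A v"
  using assms by (simp add: swaps_def swap_leaves_def tree_vertices_def)

section \<open>Conjugation by the kernel\<close>

lemma group_hom_level_proj: "group_hom (W n) (W (n - 1)) (level_proj n)"
  by (simp add: group_hom_def group_hom_axioms_def group_W level_proj_hom del: One_nat_def)

lemma level_proj_conj_by:
  assumes h: "h \<in> carrier (W n)" and a: "a \<in> K n"
  shows "level_proj n (conj_by n h a) = level_proj n h"
proof -
  interpret group_hom "W n" "W (n - 1)" "level_proj n" by (rule group_hom_level_proj)
  have "a \<in> carrier (W n)" "level_proj n a = \<one>\<^bsub>W (n - 1)\<^esub>"
    using a by (auto simp: K_def kernel_def)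
  then show ?thesis using h by (simp add: conj_by_def del: One_nat_def)
qed

text \<open>With the inverse cleared, labels can be compared by the product formula alone.\<close>

lemma conj_by_eqI:
  assumes "h \<in> carrier (W n)" "g \<in> carrier (W n)" "a \<in> carrier (W n)"
    and "h \<otimes>\<^bsub>W n\<^esub> a = a \<otimes>\<^bsub>W n\<^esub> g"
  shows "conj_by n h a = g"
proof -
  interpret group "W n" by (rule group_W)
  show ?thesis using assms by (simp add: conj_by_def m_assoc inv_solve_left')
qed

lemma mult_conj_by:
  assumes "h \<in> carrier (W n)" "a \<in> carrier (W n)"
  shows "h \<otimes>\<^bsub>W n\<^esub> a = a \<otimes>\<^bsub>W n\<^esub> conj_by n h a"
proof -
  interpret group "W n" by (rule group_W)
  show ?thesis using assms by (simp add: conj_by_def m_assoc[symmetric])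
qed

lemma conj_by_closed:
  assumes "h \<in> carrier (W n)" "a \<in> carrier (W n)"
  shows "conj_by n h a \<in> carrier (W n)"
proof -
  interpret group "W n" by (rule group_W)
  show ?thesis using assms by (simp add: conj_by_def)
qed

text \<open>Both \<open>a\<close> and the conjugate fix \<open>v\<close>, so in the labels at
  \<open>v\<close> of \<open>h a = a (conj_by n h a)\<close> the term \<open>swaps a v\<close>
  occurs once on each side and cancels.\<close>

lemma swaps_conj_by_fixed:
  assumes h: "h \<in> carrier (W n)" and a: "a \<in> K n" and n: "n \<ge> 1"
    and v: "length v = n - 1" and hv: "h v = v"
  shows "swaps (conj_by n h a) v = swaps h v"
proof -
  have a': "a \<in> carrier (W n)" using a K_subset by blast
  have c: "conj_by n h a \<in> carrier (W n)" using conj_by_closed[OF h a'] .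
  have v': "length v < n" using v n by simp
  have cv: "conj_by n h a v = v"
    using level_proj_eqD[OF level_proj_conj_by[OF h a]] v hv by simp
  have "swaps (h \<otimes>\<^bsub>W n\<^esub> a) v = swaps (a \<otimes>\<^bsub>W n\<^esub> conj_by n h a) v"
    using mult_conj_by[OF h a'] by simp
  then show ?thesis
    using swaps_mult[OF h a' v'] swaps_mult[OF a' c v'] K_fixes[OF a, of v] v cv by auto
qed

section \<open>From elementwise to global conjugacy\<close>

lemma elementwise_imp_globally:
  assumes n: "n \<ge> 1"
    and H: "subgroup H (W n)" and G: "subgroup G (W n)"
    and card: "card H = card G"
    and HK: "H \<inter> K n = {\<one>\<^bsub>W n\<^esub>}"
    and elt: "elementwise_K_conj_into n H G"
  shows "globally_K_conj_into n H G"
proof -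
  interpret group_hom "W n" "W (n - 1)" "level_proj n" by (rule group_hom_level_proj)
  interpret Hg: group "W n\<lparr>carrier := H\<rparr>"
    by (rule subgroup.subgroup_is_group[OF H group_W])
  have HW: "h \<in> carrier (W n)" if "h \<in> H" for h using subgroup.mem_carrier[OF H that] .
  have GW: "g \<in> carrier (W n)" if "g \<in> G" for g using subgroup.mem_carrier[OF G that] .
  have injH: "h = k" if "h \<in> H" "k \<in> H" "level_proj n h = level_proj n k" for h k
  proof -
    have "inv\<^bsub>W n\<^esub> h \<otimes>\<^bsub>W n\<^esub> k \<in> H"
      using subgroup.m_closed[OF H] subgroup.m_inv_closed[OF H] that by blast
    moreover have "inv\<^bsub>W n\<^esub> h \<otimes>\<^bsub>W n\<^esub> k \<in> K n"
      using that HW by (simp add: K_def kernel_def del: One_nat_def)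
    ultimately have "inv\<^bsub>W n\<^esub> h \<otimes>\<^bsub>W n\<^esub> k = \<one>\<^bsub>W n\<^esub>" using HK by blast
    then have "k = h \<otimes>\<^bsub>W n\<^esub> \<one>\<^bsub>W n\<^esub>"
      using that HW by (simp add: G.inv_solve_left')
    then show ?thesis using that HW by simp
  qed
  have "\<forall>h\<in>H. \<exists>a. a \<in> K n \<and> conj_by n h a \<in> G"
    using elt by (auto simp: elementwise_K_conj_into_def)
  then obtain c where c: "\<And>h. h \<in> H \<Longrightarrow> c h \<in> K n \<and> conj_by n h (c h) \<in> G"
    by metis
  \<comment> \<open>The conjugators \<open>c h\<close> are chosen independently for each
    \<open>h\<close>, so multiplicativity of \<open>\<sigma>\<close> is not automatic; it follows
    below because both sides lie in \<open>G\<close> and have the same projection.\<close>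
  define \<sigma> where "\<sigma> h = conj_by n h (c h)" for h
  have \<sigma>G: "\<sigma> h \<in> G" if "h \<in> H" for h using c that by (simp add: \<sigma>_def)
  have \<sigma>W: "\<sigma> h \<in> carrier (W n)" if "h \<in> H" for h using GW \<sigma>G that by blast
  have \<sigma>p: "level_proj n (\<sigma> h) = level_proj n h" if "h \<in> H" for h
    using level_proj_conj_by HW c that by (simp add: \<sigma>_def)
  have "inj_on \<sigma> H" using injH \<sigma>p by (metis inj_onI)
  moreover have "finite G"
    using finite_subset[OF subgroup.subset[OF G] finite_carrier_W] .
  ultimately have surj: "\<sigma> ` H = G"
    using \<sigma>G card by (intro card_subset_eq) (auto simp: card_image)
  have injG: "g = k" if gk: "g \<in> G" "k \<in> G" "level_proj n g = level_proj n k" for g k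
  proof -
    obtain h l where hl: "h \<in> H" "l \<in> H" "g = \<sigma> h" "k = \<sigma> l"
      using gk(1,2) surj by blast
    then have "h = l" using injH[OF hl(1,2)] \<sigma>p gk(3) by simp
    then show ?thesis using hl by simp
  qed
  have \<sigma>_mult: "\<sigma> (h \<otimes>\<^bsub>W n\<^esub> k) = \<sigma> h \<otimes>\<^bsub>W n\<^esub> \<sigma> k" if "h \<in> H" "k \<in> H" for h k
  proof (rule injG)
    have hk: "h \<otimes>\<^bsub>W n\<^esub> k \<in> H" using subgroup.m_closed[OF H] that .
    then show "\<sigma> (h \<otimes>\<^bsub>W n\<^esub> k) \<in> G" by (rule \<sigma>G)
    show "\<sigma> h \<otimes>\<^bsub>W n\<^esub> \<sigma> k \<in> G" using subgroup.m_closed[OF G] \<sigma>G that by blast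
    show "level_proj n (\<sigma> (h \<otimes>\<^bsub>W n\<^esub> k)) = level_proj n (\<sigma> h \<otimes>\<^bsub>W n\<^esub> \<sigma> k)"
      using hk that \<sigma>p \<sigma>W HW by (simp del: One_nat_def)
  qed
  have \<sigma>v: "\<sigma> h v = h v" if "h \<in> H" "length v \<le> n - 1" for h v
    using level_proj_eqD[OF \<sigma>p] that by blast
  define d where "d h v \<longleftrightarrow> swaps h v \<noteq> swaps (\<sigma> h) v" for h v
  have "\<exists>A :: bool list \<Rightarrow> bool. \<forall>h\<in>carrier (W n\<lparr>carrier := H\<rparr>). \<forall>v\<in>{v. length v = n - 1}.
      d h v \<longleftrightarrow> A (h v) \<noteq> A v"
  proof (rule Hg.cocycle_vanishing_on_stabilisers_is_coboundary
      [where act = "\<lambda>h. h"], goal_cases)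
    case (1 g x) then show ?case using W_length[OF HW] by simp
  next
    case (2 x) then show ?case by (simp add: one_W tree_vertices_def)
  next
    case (3 g h x) then show ?case using mult_W_apply[OF HW HW] by (simp add: tree_vertices_def)
  next
    \<comment> \<open>\<open>\<sigma> h\<close> and \<open>h\<close> move \<open>x\<close> to the
      same vertex, so the two product formulas are evaluated at the same places and can be
      added.\<close>
    case (4 g h x)
    then have gh: "g \<in> H" "h \<in> H" and x: "length x < n" "length x \<le> n - 1" using n by auto
    show ?case
      using swaps_mult[OF HW[OF gh(1)] HW[OF gh(2)] x(1)]
        swaps_mult[OF \<sigma>W[OF gh(1)] \<sigma>W[OF gh(2)] x(1)] \<sigma>v[OF gh(2) x(2)] \<sigma>_mult[OF gh]
      by (auto simp: d_def)
  next
    \<comment> \<open>The elementwise hypothesis enters here: \<open>\<sigma> g\<close> is a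
      \<open>K n\<close>-conjugate of \<open>g\<close>, so their labels agree at a fixed
      vertex.\<close>
    case (5 g x)
    then show ?case using swaps_conj_by_fixed[OF HW _ n] c by (simp add: d_def \<sigma>_def)
  qed
  then obtain A :: "bool list \<Rightarrow> bool"
    where A: "\<And>h v. h \<in> H \<Longrightarrow> length v = n - 1 \<Longrightarrow> d h v \<longleftrightarrow> A (h v) \<noteq> A v"
    by auto
  \<comment> \<open>With labels \<open>A\<close> on level \<open>n - 1\<close>, the equation
    \<open>h a = a (\<sigma> h)\<close> becomes, label by label,
    \<open>d h v \<longleftrightarrow> A (h v) \<noteq> A v\<close>.\<close>
  define a where "a = swap_leaves n A"
  have aK: "a \<in> K n" using swap_leaves_in_K[OF n] by (simp add: a_def)
  then have aW: "a \<in> carrier (W n)" using K_subset by blast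
  have "conj_by n h a = \<sigma> h" if h: "h \<in> H" for h
  proof (rule conj_by_eqI[OF HW[OF h] \<sigma>W[OF h] aW])
    show "h \<otimes>\<^bsub>W n\<^esub> a = a \<otimes>\<^bsub>W n\<^esub> \<sigma> h"
    proof (rule W_eqI[OF _ _ n])
      show "h \<otimes>\<^bsub>W n\<^esub> a \<in> carrier (W n)" "a \<otimes>\<^bsub>W n\<^esub> \<sigma> h \<in> carrier (W n)"
        using HW[OF h] \<sigma>W[OF h] aW by auto
    next
      fix v :: "bool list" assume v: "length v < n"
      then have "length v \<le> n - 1" "length (h v) \<le> n - 1" using W_length[OF HW[OF h]] by auto
      then show "(h \<otimes>\<^bsub>W n\<^esub> a) v = (a \<otimes>\<^bsub>W n\<^esub> \<sigma> h) v"
        using v mult_W_apply[OF HW[OF h] aW] mult_W_apply[OF aW \<sigma>W[OF h]] K_fixes[OF aK] \<sigma>v[OF h]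
        by (simp add: tree_vertices_def)
    next
      fix v :: "bool list" assume v: "length v = n - 1"
      then have v': "length v < n" "length (h v) = n - 1" using W_length[OF HW[OF h]] n by auto
      show "swaps (h \<otimes>\<^bsub>W n\<^esub> a) v = swaps (a \<otimes>\<^bsub>W n\<^esub> \<sigma> h) v"
        using swaps_mult[OF HW[OF h] aW v'(1)] swaps_mult[OF aW \<sigma>W[OF h] v'(1)]
          K_fixes[OF aK, of v] \<sigma>v[OF h, of v] A[OF h v] v v'
          swaps_swap_leaves[OF n, of _ A]
        by (auto simp: d_def a_def)
    qed
  qed
  then show ?thesis using aK \<sigma>G by (auto simp: globally_K_conj_into_def intro!: bexI[of _ a])
qed

theorem theorem1p4:
  fixes n :: nat and H G :: "(bool list \<Rightarrow> bool list) set"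
  assumes "n \<ge> 1"
    and "subgroup H (W n)" and "subgroup G (W n)"
    and "card H = card G"
    and "H \<inter> K n = {\<one>\<^bsub>W n\<^esub>}"
  shows "elementwise_K_conj_into n H G \<longleftrightarrow> globally_K_conj_into n H G"
  \<comment> \<open>Conversely, a global conjugator serves for every element.\<close>
  using elementwise_imp_globally[OF assms]
  by (auto simp: elementwise_K_conj_into_def globally_K_conj_into_def)

end
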